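(* Let $\{X_t : t\in[m]\}$ be a positive scalar latent position process, let $t,s\in[m]$, and let $\mathbf{X}_t,\mathbf{X}_s\in\mathbb{R}^{n\times 1}$ be the latent position matrices with $n$ rows drawn i.i.d. from this process. Let $\sigma$ be a random permutation uniformly distributed on the symmetric group $S_n$, independent of the latent positions, and let $P_n$ be its corresponding permutation matrix. Then for any $\epsilon>0$, $$\mathbb{P}\left(\left|\hat d_{MV}^2(\mathbf{X}_t,P_n\mathbf{X}_s)-\text{ind-}d_{MV}^2(X_t,X_s)\right|\ge\epsilon\right)\le\frac{12}{n\epsilon^2}+\frac{4}{n\epsilon}.$$
   Context: $[m]=\{1,\dots,m\}$. A positive scalar latent position process is a family of real random variables $X_t$ on a common probability space, with $X_t\ge 0$ and $0\le xy\le 1$ for all $x,y$ in the support of $X_t$; hence each $X_t$ takes values in $[0,1]$. Latent position matrices: draw $\omega_1,\dots,\omega_n$ i.i.d. from the probability space; the $j$th entry of $\mathbf{X}_t$ is $X_t(\omega_j)$, for every $t$ (so the pairs $((\mathbf{X}_t)_j,(\mathbf{X}_s)_j)$, $1\le j\le n$, are i.i.d. copies of $(X_t,X_s)$). The permutation matrix of $\sigma$ acts by $(P_n\mathbf{X})_i=\mathbf{X}_{\sigma(i)}$. For $\mathbf{X},\mathbf{Y}\in\mathbb{R}^{n\times d}$, $\hat d_{MV}^2(\mathbf{X},\mathbf{Y})=\min_{W}\frac1n\|(\mathbf{X}-\mathbf{Y}W)^\top(\mathbf{X}-\mathbf{Y}W)\|_2$, the minimum being over $d\times d$ real orthogonal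 matrices $W$ and $\|\cdot\|_2$ the spectral norm (here $d=1$, so $W\in\{\pm1\}$). For random vectors $X,Y$ in $\mathbb{R}^d$ with laws $\mu_X,\mu_Y$, $\text{ind-}d_{MV}(X,Y)=\min_W\left\|\mathbb{E}_{(X',Y')\sim\mu_X\otimes\mu_Y}[(X'-WY')(X'-WY')^\top]\right\|_2^{1/2}$, with the minimum over $d\times d$ real orthogonal $W$, where $\mu_X\otimes\mu_Y$ is the product measure; $\text{ind-}d_{MV}^2$ denotes its square. *)

theory Defs
  imports "HOL-Probability.Probability"
begin

definition measure_support :: "'a::topological_space measure \<Rightarrow> 'a set" where
  "measure_support \<mu> = {x. \<forall>U. open U \<and> x \<in> U \<longrightarrow> emeasure \<mu> U > 0}"

(* The support of a random variable is the topological support of its law;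
   non-negativity is required almost surely only. *)
definition positive_scalar_LPP :: "'w measure \<Rightarrow> nat \<Rightarrow> (nat \<Rightarrow> 'w \<Rightarrow> real) \<Rightarrow> bool" where
  "positive_scalar_LPP M m X \<longleftrightarrow>
     prob_space M \<and>
     (\<forall>t\<in>{1..m}.
        X t \<in> borel_measurable M \<and>
        (AE w in M. 0 \<le> X t w) \<and>
        (\<forall>x\<in>measure_support (distr M borel (X t)). \<forall>y\<in>measure_support (distr M borel (X t)).
           0 \<le> x * y \<and> x * y \<le> 1))"

definition scalar_rv :: "('w \<Rightarrow> real) \<Rightarrow> 'w \<Rightarrow> real^1" where
  "scalar_rv x = (\<lambda>w. vec (x w))"

(* Rows are indexed by the finite type 'n, so the number of rows is CARD('n). *)
definition latent_matrix :: "('w \<Rightarrow> real^'d) \<Rightarrow> ('n::finite \<Rightarrow> 'w) \<Rightarrow> real^'d^'n" where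
  "latent_matrix x \<omega> = (\<chi> j. x (\<omega> j))"

definition perm_matrix :: "('n::finite \<Rightarrow> 'n) \<Rightarrow> real^'n^'n" where
  "perm_matrix \<sigma> = (\<chi> i j. if j = \<sigma> i then 1 else 0)"

lemma perm_matrix_row: "(perm_matrix \<sigma> ** A) $ i = A $ \<sigma> i"
  by (simp add: vec_eq_iff perm_matrix_def matrix_matrix_mult_def if_distrib if_distribR
      cong: if_cong)

definition spectral_norm :: "real^'d^'e \<Rightarrow> real" where
  "spectral_norm A = onorm ((*v) A)"

(* In the next two definitions the minimum over the orthogonal group is written as an
   infimum of a family bounded below by 0. For d = 1 the orthogonal group is finite
   (see orthogonal_matrix_1 below), so there the infimum is attained. *)
definition dMV_hat_sq :: "real^'d^'n \<Rightarrow> real^'d^'n \<Rightarrow> real" where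
  "dMV_hat_sq A B =
     (INF W\<in>{W. orthogonal_matrix W}.
        spectral_norm (transpose (A - B ** W) ** (A - B ** W)) / real CARD('n))"

definition ind_dMV :: "'w measure \<Rightarrow> ('w \<Rightarrow> real^'d) \<Rightarrow> ('w \<Rightarrow> real^'d) \<Rightarrow> real" where
  "ind_dMV M x y =
     (INF W\<in>{W. orthogonal_matrix W}.
        sqrt (spectral_norm
          (LINT (x', y')|(distr M borel x \<Otimes>\<^sub>M distr M borel y).
             (columnvector (x' - W *v y') :: real^1^'d)
               ** transpose (columnvector (x' - W *v y')))))"

lemma orthogonal_matrix_1: "{W :: real^1^1. orthogonal_matrix W} = {mat 1, - mat 1}"
  by (auto simp: orthogonal_matrix_def vec_eq_iff matrix_matrix_mult_def transpose_def mat_def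
      power2_eq_square[symmetric] power2_eq_1_iff)

(* The library's indep_var forces both random variables to have the same value type;
   this is its characterization indep_var_eq, for two arbitrary value types. *)
definition indep_rv ::
  "'o measure \<Rightarrow> 'a measure \<Rightarrow> ('o \<Rightarrow> 'a) \<Rightarrow> 'b measure \<Rightarrow> ('o \<Rightarrow> 'b) \<Rightarrow> bool" where
  "indep_rv N S A T B \<longleftrightarrow>
     A \<in> measurable N S \<and> B \<in> measurable N T \<and>
     prob_space.indep_set N
       (sigma_sets (space N) {A -` a \<inter> space N | a. a \<in> sets S})
       (sigma_sets (space N) {B -` b \<inter> space N | b. b \<in> sets T})"

end

theory Submission
  imports Defs
begin

text \<open>
  Since the latent positions lie in \<open>[0, 1]\<close> almost surely, the sign \<open>W = 1\<close> is optimal in both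
  minima (\<open>(a - b)\<^sup>2 \<le> (a + b)\<^sup>2\<close> for \<open>a, b \<ge> 0\<close>). So the claim compares the average of
  \<open>(X t (\<omega> j) - X s (\<omega> (\<sigma> j)))\<^sup>2\<close> over \<open>j\<close> with \<open>\<theta> = E (X' - Y')\<^sup>2\<close>, where \<open>X'\<close> and \<open>Y'\<close> are
  independent with the laws of \<open>X t\<close> and \<open>X s\<close>.

  For a fixed permutation \<open>p\<close>, the centered summands \<open>Y j\<close> (the squared difference at \<open>j\<close> minus
  \<open>\<theta>\<close>) are bounded by 1. If \<open>p j \<noteq> j\<close>, the sample points \<open>\<omega> j\<close> and \<open>\<omega> (p j)\<close> are independent and
  \<open>Y j\<close> has mean zero; moreover \<open>Y j\<close> and \<open>Y k\<close> are independent as soon as \<open>{j, p j}\<close> and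
  \<open>{k, p k}\<close> are disjoint. Hence \<open>E (Y j * Y k)\<close> vanishes unless \<open>k \<in> {j, p j, inv p j}\<close> or \<open>j\<close> is
  a fixed point of \<open>p\<close>, and the mean square deviation is at most \<open>(3 + f p) / n\<close>, with \<open>f p\<close> the
  number of fixed points (lemma \<open>permuted_kernel_second_moment\<close>). The independence of \<open>\<sigma>\<close> and the
  latent matrices lets Chebyshev's inequality be applied for each value of \<open>\<sigma>\<close> separately. A uniform
  permutation has one fixed point on average (lemma \<open>sum_card_fixed_points\<close>), so averaging gives
  \<open>4 / (n * \<epsilon>\<^sup>2)\<close>. Working with the deviation from \<open>\<theta>\<close>, rather than from the mean, accounts for the
  bias and the variance at once.
\<close>

section \<open>Latent positions in the unit interval\<close>

text \<open>
  Every point outside the support has a null neighbourhood from a countable basis, so the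
  complement of the support is covered by countably many null sets.
\<close>

lemma AE_in_measure_support:
  fixes \<mu> :: "'a::second_countable_topology measure"
  assumes sets: "sets \<mu> = sets borel"
  shows "AE x in \<mu>. x \<in> measure_support \<mu>"
proof -
  obtain B :: "'a set set" where B: "countable B" "topological_basis B"
    using ex_countable_basis by blast
  define C where "C = {b \<in> B. emeasure \<mu> b = 0}"
  have "b \<in> null_sets \<mu>" if "b \<in> C" for b
    using that topological_basis_open[OF B(2), of b] sets by (auto simp: C_def null_sets_def)
  moreover have "countable C"
    using B(1) unfolding C_def by auto
  ultimately have null: "(\<Union>b\<in>C. b) \<in> null_sets \<mu>"
    by (intro null_sets_UN') auto
  show ?thesis
  proof (rule AE_I'[OF null], safe)
    fix x assume "x \<notin> measure_support \<mu>"
    then obtain U where U: "open U" "x \<in> U" "emeasure \<mu> U = 0"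
      by (auto simp: measure_support_def zero_less_iff_neq_zero)
    then obtain b where b: "b \<in> B" "x \<in> b" "b \<subseteq> U"
      using topological_basisE[OF B(2)] by blast
    have "U \<in> sets \<mu>" using U(1) sets by auto
    then have "emeasure \<mu> b = 0"
      using emeasure_mono[OF b(3), of \<mu>] U(3) by simp
    then show "x \<in> (\<Union>b\<in>C. b)" using b by (auto simp: C_def)
  qed
qed

text \<open>
  Taking \<open>y = x\<close> in the support condition gives \<open>x\<^sup>2 \<le> 1\<close> on the support, hence almost surely.
\<close>

lemma positive_scalar_LPP_unit_interval:
  assumes lpp: "positive_scalar_LPP M m X" and t: "t \<in> {1..m}"
  shows "AE w in M. 0 \<le> X t w \<and> X t w \<le> 1"
proof -
  have meas [measurable]: "X t \<in> borel_measurable M"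
    and nonneg: "AE w in M. 0 \<le> X t w"
    and supp: "\<And>x. x \<in> measure_support (distr M borel (X t)) \<Longrightarrow> x * x \<le> 1"
    using lpp t by (auto simp: positive_scalar_LPP_def)
  have "AE x in distr M borel (X t). x \<in> measure_support (distr M borel (X t))"
    by (rule AE_in_measure_support) simp
  then have "AE w in M. X t w \<in> measure_support (distr M borel (X t))"
    by (rule AE_distrD[OF meas])
  with nonneg show ?thesis
  proof eventually_elim
    case (elim w)
    then have "(X t w)\<^sup>2 \<le> 1\<^sup>2" using supp by (simp add: power2_eq_square)
    then show ?case using elim(1) power2_le_imp_le[of "X t w" 1] by simp
  qed
qed

section \<open>The two dissimilarities in dimension one\<close>

lemma spectral_norm_1x1:
  fixes A :: "real^1^1"
  shows "spectral_norm A = \<bar>A $ 1 $ 1\<bar>"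
proof -
  have "(*v) A = (\<lambda>v. (A $ 1 $ 1) *\<^sub>R v)"
    by (auto simp: fun_eq_iff vec_eq_iff matrix_vector_mult_def)
  then show ?thesis
    by (simp add: spectral_norm_def onorm_scaleR[OF bounded_linear_ident] onorm_id)
qed

text \<open>
  The minimum over both signs is kept here because this form is measurable in the entries
  of the matrices everywhere; which sign wins is known only almost surely.
\<close>

lemma dMV_hat_sq_scalar:
  fixes A B :: "real^1^'n::finite"
  shows "dMV_hat_sq A B =
    min ((\<Sum>j\<in>UNIV. (A $ j $ 1 - B $ j $ 1)\<^sup>2) / real CARD('n))
        ((\<Sum>j\<in>UNIV. (A $ j $ 1 + B $ j $ 1)\<^sup>2) / real CARD('n))"
proof -
  have plus: "spectral_norm (transpose (A - B ** mat 1) ** (A - B ** mat 1))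
      = (\<Sum>j\<in>UNIV. (A $ j $ 1 - B $ j $ 1)\<^sup>2)"
    by (simp add: spectral_norm_1x1 matrix_matrix_mult_def transpose_def mat_def
        power2_eq_square[symmetric] sum_nonneg)
  have minus: "spectral_norm (transpose (A - B ** (- mat 1)) ** (A - B ** (- mat 1)))
      = (\<Sum>j\<in>UNIV. (A $ j $ 1 + B $ j $ 1)\<^sup>2)"
    by (simp add: spectral_norm_1x1 matrix_matrix_mult_def transpose_def mat_def
        power2_eq_square[symmetric] sum_nonneg)
  show ?thesis
    unfolding dMV_hat_sq_def orthogonal_matrix_1
    by (simp add: plus[unfolded matrix_mul_rid] minus cInf_insert inf_min)
qed

lemma dMV_hat_sq_nonneg_scalar:
  fixes A B :: "real^1^'n::finite"
  assumes "\<And>j. 0 \<le> A $ j $ 1" "\<And>j. 0 \<le> B $ j $ 1"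
  shows "dMV_hat_sq A B = (\<Sum>j\<in>UNIV. (A $ j $ 1 - B $ j $ 1)\<^sup>2) / real CARD('n)"
proof -
  have "(A $ j $ 1 - B $ j $ 1)\<^sup>2 \<le> (A $ j $ 1 + B $ j $ 1)\<^sup>2" for j
    using mult_nonneg_nonneg[OF assms(1)[of j] assms(2)[of j]]
    by (simp add: power2_eq_square algebra_simps)
  then have "(\<Sum>j\<in>UNIV. (A $ j $ 1 - B $ j $ 1)\<^sup>2) \<le> (\<Sum>j\<in>UNIV. (A $ j $ 1 + B $ j $ 1)\<^sup>2)"
    by (intro sum_mono)
  then show ?thesis
    by (simp add: dMV_hat_sq_scalar min_def divide_right_mono)
qed

lemma AE_pair_fst_snd:
  assumes "prob_space M" "prob_space M'"
    and P: "AE w in M. P w" and Q: "AE w in M'. Q w"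
  shows "AE v in M \<Otimes>\<^sub>M M'. P (fst v) \<and> Q (snd v)"
proof -
  interpret M': prob_space M' by fact
  obtain A where A: "\<And>w. w \<in> space M - A \<Longrightarrow> P w" "A \<in> null_sets M"
    using AE_E3[OF P] by blast
  obtain B where B: "\<And>w. w \<in> space M' - B \<Longrightarrow> Q w" "B \<in> null_sets M'"
    using AE_E3[OF Q] by blast
  have "A \<times> space M' \<union> space M \<times> B \<in> null_sets (M \<Otimes>\<^sub>M M')"
    using A(2) B(2) by (intro null_sets.Un) (auto simp: null_sets_def M'.emeasure_pair_measure_Times)
  then show ?thesis
    by (rule AE_I') (use A(1) B(1) in \<open>fastforce simp: space_pair_measure\<close>)
qed

text \<open>
  The sign \<open>W = -1\<close> only increases the integrand, because the two coordinates of the product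
  measure are non-negative almost surely. The upper bound by 1 makes the integrands integrable.
\<close>

lemma ind_dMV_nonneg_scalar:
  fixes x y :: "'w \<Rightarrow> real"
  assumes M: "prob_space M"
    and x [measurable]: "x \<in> borel_measurable M" and y [measurable]: "y \<in> borel_measurable M"
    and x_unit: "AE w in M. 0 \<le> x w \<and> x w \<le> 1" and y_unit: "AE w in M. 0 \<le> y w \<and> y w \<le> 1"
  shows "(ind_dMV M (scalar_rv x) (scalar_rv y))\<^sup>2
    = (LINT v|(M \<Otimes>\<^sub>M M). (x (fst v) - y (snd v))\<^sup>2)"
proof -
  interpret M: prob_space M by fact
  interpret MM: pair_prob_space M M ..
  have vec_meas: "(vec :: real \<Rightarrow> real^1) \<in> borel_measurable borel"
    unfolding vec_def by (intro borel_measurable_continuous_onI continuous_intros)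
  have sx [measurable]: "scalar_rv x \<in> borel_measurable M"
    and sy [measurable]: "scalar_rv y \<in> borel_measurable M"
    using vec_meas x y unfolding scalar_rv_def by (blast intro: measurable_compose)+
  interpret dy: prob_space "distr M borel (scalar_rv y)"
    by (rule M.prob_space_distr) simp
  have AE_unit: "AE v in M \<Otimes>\<^sub>M M. (0 \<le> x (fst v) \<and> x (fst v) \<le> 1) \<and> (0 \<le> y (snd v) \<and> y (snd v) \<le> 1)"
    by (rule AE_pair_fst_snd[OF M M x_unit y_unit])
  have bound: "(a - c * b)\<^sup>2 \<le> 4"
    if "0 \<le> a" "a \<le> 1" "0 \<le> b" "b \<le> 1" "\<bar>c\<bar> = 1" for a b c :: real
  proof -
    have "\<bar>c * b\<bar> \<le> 1" using that by (simp add: abs_mult)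
    then have "\<bar>a - c * b\<bar> \<le> 2" using that by linarith
    then show ?thesis using power2_le_iff_abs_le[of 2 "a - c * b"] by simp
  qed
  have AE_bound: "AE v in M \<Otimes>\<^sub>M M. norm ((x (fst v) - c * y (snd v))\<^sup>2) \<le> 4" if "\<bar>c\<bar> = 1" for c
    using AE_unit by eventually_elim (simp add: bound that)
  have int: "integrable (M \<Otimes>\<^sub>M M) (\<lambda>v. (x (fst v) - c * y (snd v))\<^sup>2)" if "\<bar>c\<bar> = 1" for c
    by (rule MM.P.integrable_const_bound[OF AE_bound[OF that]]) measurable
  have entry: "spectral_norm
      (LINT (x', y')|(distr M borel (scalar_rv x) \<Otimes>\<^sub>M distr M borel (scalar_rv y)).
         (columnvector (x' - W *v y') :: real^1^1) ** transpose (columnvector (x' - W *v y')))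
      = (LINT v|(M \<Otimes>\<^sub>M M). (x (fst v) - c * y (snd v))\<^sup>2)"
    if W: "W = c *\<^sub>R mat 1" and c: "\<bar>c\<bar> = 1" for W :: "real^1^1" and c
  proof -
    \<comment> \<open>The isomorphism from the reals to the 1 by 1 matrices, by which the matrix-valued integral
        reduces to a scalar one.\<close>
    define E :: "real \<Rightarrow> real^1^1" where "E = (\<lambda>a. \<chi> i j. a)"
    have E: "bounded_linear E"
      by (intro linear_conv_bounded_linear[THEN iffD1] linearI) (auto simp: E_def vec_eq_iff)
    have "(LINT (x', y')|(distr M borel (scalar_rv x) \<Otimes>\<^sub>M distr M borel (scalar_rv y)).
         (columnvector (x' - W *v y') :: real^1^1) ** transpose (columnvector (x' - W *v y')))
       = (LINT (x', y')|(distr M borel (scalar_rv x) \<Otimes>\<^sub>M distr M borel (scalar_rv y)).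
         E ((x' $ 1 - c * y' $ 1)\<^sup>2))"
      by (intro Bochner_Integration.integral_cong refl)
        (auto simp: E_def vec_eq_iff columnvector_def matrix_matrix_mult_def transpose_def
          matrix_vector_mult_def W mat_def power2_eq_square)
    also have "\<dots> = (LINT v|(M \<Otimes>\<^sub>M M). E ((x (fst v) - c * y (snd v))\<^sup>2))"
    proof -
      have cont: "(\<lambda>u :: (real^1) \<times> (real^1). E ((fst u $ 1 - c * snd u $ 1)\<^sup>2)) \<in> borel_measurable (borel \<Otimes>\<^sub>M borel)"
        unfolding borel_prod E_def by (intro borel_measurable_continuous_onI continuous_intros)
      have "distr M borel (scalar_rv x) \<Otimes>\<^sub>M distr M borel (scalar_rv y)
          = distr (M \<Otimes>\<^sub>M M) (borel \<Otimes>\<^sub>M borel) (\<lambda>(u, v). (scalar_rv x u, scalar_rv y v))"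
        by (rule pair_measure_distr[OF sx sy]) unfold_locales
      then show ?thesis
        by (simp add: integral_distr[OF _ cont] case_prod_beta') (simp add: scalar_rv_def)
    qed
    also have "\<dots> = E (LINT v|(M \<Otimes>\<^sub>M M). (x (fst v) - c * y (snd v))\<^sup>2)"
      by (rule integral_bounded_linear[OF E int[OF c]])
    finally show ?thesis
      by (simp add: spectral_norm_1x1 E_def)
  qed
  have plus: "(LINT v|(M \<Otimes>\<^sub>M M). (x (fst v) - 1 * y (snd v))\<^sup>2)
      \<le> (LINT v|(M \<Otimes>\<^sub>M M). (x (fst v) - (-1) * y (snd v))\<^sup>2)"
    using AE_unit
  proof (intro integral_mono_AE int, simp_all, eventually_elim)
    case (elim v)
    then have "0 \<le> x (fst v) * y (snd v)" by simp
    then show ?case by (simp add: power2_eq_square algebra_simps)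
  qed
  show ?thesis
    unfolding ind_dMV_def orthogonal_matrix_1
    using plus by (simp add: entry[of "mat 1" 1, unfolded matrix_vector_mul_lid] entry[of "- mat 1" "-1"] cInf_insert inf_min min_def)
qed

section \<open>Fixed points of a uniform permutation\<close>

text \<open>
  A double count: each point is fixed by \<open>(n - 1)!\<close> permutations. So the mean number of fixed
  points of a uniform permutation is 1.
\<close>

lemma sum_card_fixed_points:
  "(\<Sum>p\<in>{p :: 'n::finite \<Rightarrow> 'n. p permutes UNIV}. card {j. p j = j}) = fact CARD('n)"
proof -
  have fin: "finite {p :: 'n \<Rightarrow> 'n. p permutes UNIV}" by (rule finite_permutations) simp
  have fixing: "card {p. p permutes UNIV \<and> p j = j} = fact (CARD('n) - 1)" for j :: 'n
  proof -
    have "{p. p permutes UNIV \<and> p j = j} = {p. p permutes (UNIV - {j})}"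
      by (auto intro: permutes_superset permutes_subset dest: permutes_not_in)
    then show ?thesis by (simp add: card_permutations card_Diff_singleton)
  qed
  have "(\<Sum>p\<in>{p :: 'n \<Rightarrow> 'n. p permutes UNIV}. card {j. p j = j})
      = (\<Sum>p\<in>{p :: 'n \<Rightarrow> 'n. p permutes UNIV}. \<Sum>j\<in>UNIV. if p j = j then 1 else 0)"
    by (simp add: sum.If_cases)
  also have "\<dots> = (\<Sum>j\<in>UNIV. \<Sum>p\<in>{p :: 'n \<Rightarrow> 'n. p permutes UNIV}. if p j = j then 1 else 0)"
    by (rule sum.swap)
  also have "\<dots> = (\<Sum>j\<in>(UNIV :: 'n set). card {p. p permutes UNIV \<and> p j = j})"
    using fin by (simp add: sum.If_cases Int_def)
  also have "\<dots> = CARD('n) * fact (CARD('n) - 1)"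
    by (simp add: fixing)
  also have "\<dots> = fact CARD('n)"
    by (simp add: fact_reduce[of "CARD('n)"])
  finally show ?thesis .
qed

section \<open>Kernel averages along a fixed permutation\<close>

text \<open>
  In the expansion of the square of the sum of the centered summands, for each \<open>j\<close> only the indices
  \<open>j\<close>, \<open>p j\<close> and \<open>inv p j\<close> can share a sample point with \<open>j\<close>; they give the 3. A fixed point \<open>j\<close> has
  a summand on the diagonal, whose mean need not vanish; all its \<open>n\<close> products are bounded by 1, and
  this gives the number of fixed points. The bounds on the diagonal are a separate hypothesis
  because the diagonal may be a null set of the product measure.
\<close>

lemma permuted_kernel_second_moment:
  fixes \<omega> :: "'n::finite \<Rightarrow> 'o \<Rightarrow> 'w" and g :: "'w \<times> 'w \<Rightarrow> real"
  assumes N: "prob_space N"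
    and indep: "prob_space.indep_vars N (\<lambda>_. M) \<omega> UNIV"
    and law: "\<And>j. distr N M (\<omega> j) = M"
    and g [measurable]: "g \<in> borel_measurable (M \<Otimes>\<^sub>M M)"
    and g_pair: "AE v in M \<Otimes>\<^sub>M M. 0 \<le> g v \<and> g v \<le> 1"
    and g_diag: "AE w in M. 0 \<le> g (w, w) \<and> g (w, w) \<le> 1"
    and p: "p permutes UNIV"
  defines "\<theta> \<equiv> LINT v|(M \<Otimes>\<^sub>M M). g v"
  shows "integrable N (\<lambda>z. ((\<Sum>j\<in>UNIV. g (\<omega> j z, \<omega> (p j) z)) / real CARD('n) - \<theta>)\<^sup>2)"
    and "(LINT z|N. ((\<Sum>j\<in>UNIV. g (\<omega> j z, \<omega> (p j) z)) / real CARD('n) - \<theta>)\<^sup>2)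
      \<le> (3 + real (card {j. p j = j})) / real CARD('n)"
proof -
  interpret N: prob_space N by fact
  have om [measurable]: "\<omega> j \<in> measurable N M" for j
    using indep by (auto simp: N.indep_vars_def)
  have M: "prob_space M" using N.prob_space_distr[OF om] law by simp
  interpret M: prob_space M by fact
  interpret MM: pair_prob_space M M ..
  have pair_law: "distr N (M \<Otimes>\<^sub>M M) (\<lambda>z. (\<omega> i z, \<omega> j z)) = M \<Otimes>\<^sub>M M" if "i \<noteq> j" for i j
  proof -
    have "N.indep_var (PiM {i} (\<lambda>_. M)) (\<lambda>z. \<lambda>k\<in>{i}. \<omega> k z) (PiM {j} (\<lambda>_. M)) (\<lambda>z. \<lambda>k\<in>{j}. \<omega> k z)"
      using that by (intro N.indep_var_restrict[OF indep]) auto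
    then have "N.indep_var M ((\<lambda>f. f i) \<circ> (\<lambda>z. \<lambda>k\<in>{i}. \<omega> k z)) M ((\<lambda>f. f j) \<circ> (\<lambda>z. \<lambda>k\<in>{j}. \<omega> k z))"
      by (rule N.indep_var_compose) auto
    then have "N.indep_var M (\<omega> i) M (\<omega> j)" by (simp add: comp_def)
    then show ?thesis using law by (simp add: N.indep_var_distribution_eq)
  qed
  have g_om: "AE z in N. 0 \<le> g (\<omega> i z, \<omega> j z) \<and> g (\<omega> i z, \<omega> j z) \<le> 1" for i j
  proof (cases "i = j")
    case True
    have "AE w in distr N M (\<omega> i). 0 \<le> g (w, w) \<and> g (w, w) \<le> 1"
      using g_diag unfolding law .
    from AE_distrD[OF om this] True show ?thesis by simp
  next
    case False
    have "AE v in distr N (M \<Otimes>\<^sub>M M) (\<lambda>z. (\<omega> i z, \<omega> j z)). 0 \<le> g v \<and> g v \<le> 1"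
      using g_pair unfolding pair_law[OF False] .
    from AE_distrD[OF _ this] show ?thesis by simp
  qed
  have g_int: "integrable (M \<Otimes>\<^sub>M M) g"
    using g_pair by (intro MM.P.integrable_const_bound[where B = 1]) auto
  have \<theta>_unit: "0 \<le> \<theta>" "\<theta> \<le> 1"
    unfolding \<theta>_def using g_pair g_int
    by (auto intro!: integral_nonneg_AE MM.P.integral_le_const)
  define Y where "Y = (\<lambda>j z. g (\<omega> j z, \<omega> (p j) z) - \<theta>)"
  have Y_meas [measurable]: "Y j \<in> borel_measurable N" for j
    unfolding Y_def by measurable
  have Y_bound: "AE z in N. \<bar>Y j z\<bar> \<le> 1" for j
    using g_om[of j "p j"] by eventually_elim (use \<theta>_unit in \<open>auto simp: Y_def\<close>)
  have Y_int: "integrable N (Y j)" for j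
    using Y_bound by (intro N.integrable_const_bound[where B = 1]) auto
  have YY_bound: "AE z in N. \<bar>Y j z * Y k z\<bar> \<le> 1" for j k
    using Y_bound[of j] Y_bound[of k] by eventually_elim (auto simp: abs_mult intro: mult_le_one)
  have YY_int: "integrable N (\<lambda>z. Y j z * Y k z)" for j k
    using YY_bound by (intro N.integrable_const_bound[where B = 1]) auto
  have YY_le: "(LINT z|N. Y j z * Y k z) \<le> 1" for j k
    using YY_bound[of j k] YY_int by (intro N.integral_le_const) (auto elim!: eventually_mono)
  have Y_mean: "(LINT z|N. Y j z) = 0" if "p j \<noteq> j" for j
  proof -
    have "(LINT z|N. g (\<omega> j z, \<omega> (p j) z)) = (LINT v|(distr N (M \<Otimes>\<^sub>M M) (\<lambda>z. (\<omega> j z, \<omega> (p j) z))). g v)"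
      by (subst integral_distr) auto
    also have "\<dots> = \<theta>" using that by (simp add: pair_law \<theta>_def)
    finally have eq: "(LINT z|N. g (\<omega> j z, \<omega> (p j) z)) = \<theta>" .
    have "integrable N (\<lambda>z. g (\<omega> j z, \<omega> (p j) z))"
      using g_om[of j "p j"] by (intro N.integrable_const_bound[where B = 1]) auto
    then show ?thesis by (simp add: Y_def eq N.prob_space)
  qed
  have p_inj: "p a = p b \<longleftrightarrow> a = b" for a b
    using permutes_inj[OF p] by (auto dest: injD)
  have YY_zero: "(LINT z|N. Y j z * Y k z) = 0"
    if "k \<noteq> j" "k \<noteq> p j" "p k \<noteq> j" "p j \<noteq> j" for j k
  proof -
    let ?J = "{j, p j}" and ?K = "{k, p k}"
    let ?h = "\<lambda>i f. g (f i, f (p i)) - \<theta>"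
    have "N.indep_var (PiM ?J (\<lambda>_. M)) (\<lambda>z. \<lambda>i\<in>?J. \<omega> i z) (PiM ?K (\<lambda>_. M)) (\<lambda>z. \<lambda>i\<in>?K. \<omega> i z)"
      using that p_inj[of j k] by (intro N.indep_var_restrict[OF indep]) auto
    then have "N.indep_var borel (?h j \<circ> (\<lambda>z. \<lambda>i\<in>?J. \<omega> i z)) borel (?h k \<circ> (\<lambda>z. \<lambda>i\<in>?K. \<omega> i z))"
      by (rule N.indep_var_compose) measurable
    then have "N.indep_var borel (Y j) borel (Y k)" by (simp add: comp_def Y_def)
    then show ?thesis
      using N.indep_var_lebesgue_integral[OF _ Y_int Y_int] Y_mean[OF that(4)] by simp
  qed
  \<comment> \<open>The mean-zero factor is \<open>Y j\<close>, so only fixed points among the \<open>j\<close>, not among the \<open>k\<close>, are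
      charged.\<close>
  have YY: "(LINT z|N. Y j z * Y k z) \<le> of_bool (k = j) + of_bool (k = p j) + of_bool (p k = j)
      + of_bool (p j = j)" for j k
    using YY_le[of j k] YY_zero[of k j] by (cases "k = j \<or> k = p j \<or> p k = j \<or> p j = j") auto
  let ?n = "real CARD('n)"
  have dev: "((\<Sum>j\<in>UNIV. g (\<omega> j z, \<omega> (p j) z)) / ?n - \<theta>)\<^sup>2
      = (\<Sum>j\<in>UNIV. \<Sum>k\<in>UNIV. Y j z * Y k z) / ?n\<^sup>2" for z
  proof -
    have "(\<Sum>j\<in>UNIV. g (\<omega> j z, \<omega> (p j) z)) / ?n - \<theta> = (\<Sum>j\<in>UNIV. Y j z) / ?n"
      by (simp add: Y_def sum_subtractf diff_divide_distrib)
    then show ?thesis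
      by (simp add: power_divide power2_eq_square sum_product)
  qed
  show "integrable N (\<lambda>z. ((\<Sum>j\<in>UNIV. g (\<omega> j z, \<omega> (p j) z)) / ?n - \<theta>)\<^sup>2)"
    unfolding dev using YY_int by (intro integrable_divide_zero Bochner_Integration.integrable_sum) auto
  have preimage: "(\<Sum>k\<in>UNIV. of_bool (p k = j)) = (1::real)" for j
  proof -
    have "p k = j \<longleftrightarrow> k = inv p j" for k
      using permutes_inverses[OF p] by metis
    then show ?thesis by (simp add: of_bool_def)
  qed
  have "(LINT z|N. ((\<Sum>j\<in>UNIV. g (\<omega> j z, \<omega> (p j) z)) / ?n - \<theta>)\<^sup>2)
      = (\<Sum>j\<in>UNIV. \<Sum>k\<in>UNIV. LINT z|N. Y j z * Y k z) / ?n\<^sup>2"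
    unfolding dev using YY_int by simp
  also have "\<dots> \<le> (\<Sum>j\<in>UNIV. \<Sum>k\<in>UNIV. of_bool (k = j) + of_bool (k = p j) + of_bool (p k = j)
      + of_bool (p j = j)) / ?n\<^sup>2"
    by (intro divide_right_mono sum_mono YY) auto
  also have "\<dots> = (\<Sum>j\<in>UNIV. 3 + ?n * of_bool (p j = j)) / ?n\<^sup>2"
    unfolding sum.distrib preimage by (simp add: sum.distrib of_bool_def)
  also have "\<dots> = (3 * ?n + ?n * real (card {j. p j = j})) / ?n\<^sup>2"
    by (simp add: sum.distrib sum_distrib_left[symmetric] of_bool_def sum.If_cases)
  also have "\<dots> = (3 + real (card {j. p j = j})) / ?n"
    by (simp add: power2_eq_square field_simps)
  finally show "(LINT z|N. ((\<Sum>j\<in>UNIV. g (\<omega> j z, \<omega> (p j) z)) / ?n - \<theta>)\<^sup>2)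
      \<le> (3 + real (card {j. p j = j})) / ?n" .
qed

section \<open>Concentration for randomly permuted latent positions\<close>

text \<open>
  The event is split according to the value of \<open>\<sigma>\<close>. For a fixed permutation it depends on the latent
  matrices only, so it is independent of \<open>\<sigma>\<close>, and its probability is bounded by Chebyshev's
  inequality. The average of these bounds is already \<open>4 / (n * \<epsilon>\<^sup>2)\<close>.
\<close>

theorem theorem1:
  fixes M :: "'w measure" and N :: "'o measure"
    and X :: "nat \<Rightarrow> 'w \<Rightarrow> real" and m t s :: nat
    and \<omega> :: "'n::finite \<Rightarrow> 'o \<Rightarrow> 'w"
    and \<sigma> :: "'o \<Rightarrow> 'n \<Rightarrow> 'n"
    and \<epsilon> :: real
  defines "n \<equiv> real CARD('n)"
    and "S \<equiv> {p :: 'n \<Rightarrow> 'n. p permutes UNIV}"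
    and "XX \<equiv> \<lambda>r z. latent_matrix (scalar_rv (X r)) (\<lambda>j. \<omega> j z)"
  assumes lpp: "positive_scalar_LPP M m X"
    and t: "t \<in> {1..m}" and s: "s \<in> {1..m}"
    and N: "prob_space N"
    and iid_indep: "prob_space.indep_vars N (\<lambda>_. M) \<omega> UNIV"
    and iid_law: "\<And>j. distr N M (\<omega> j) = M"
    and sigma_law: "distr N (count_space S) \<sigma> = uniform_count_measure S"
    and sigma_indep: "indep_rv N
          (\<Pi>\<^sub>M r\<in>{1..m}. borel) (\<lambda>z. \<lambda>r\<in>{1..m}. XX r z)
          (count_space S) \<sigma>"
    and eps: "\<epsilon> > 0"
  shows "measure N {z \<in> space N.
           \<bar>dMV_hat_sq (XX t z) (perm_matrix (\<sigma> z) ** XX s z)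
             - (ind_dMV M (scalar_rv (X t)) (scalar_rv (X s)))\<^sup>2\<bar> \<ge> \<epsilon>}
         \<le> 12 / (n * \<epsilon>\<^sup>2) + 4 / (n * \<epsilon>)"
proof -
  interpret N: prob_space N by (rule N)
  have M: "prob_space M" using lpp by (simp add: positive_scalar_LPP_def)
  have meas [measurable]: "X r \<in> borel_measurable M" if "r \<in> {1..m}" for r
    using lpp that by (auto simp: positive_scalar_LPP_def)
  note [measurable] = meas[OF t] meas[OF s]
  note unit = positive_scalar_LPP_unit_interval[OF lpp]
  have om [measurable]: "\<omega> j \<in> measurable N M" for j
    using iid_indep by (auto simp: N.indep_vars_def)
  define g where "g = (\<lambda>v. (X t (fst v) - X s (snd v))\<^sup>2)"
  define \<theta> where "\<theta> = (LINT v|(M \<Otimes>\<^sub>M M). g v)"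
  have \<theta>: "(ind_dMV M (scalar_rv (X t)) (scalar_rv (X s)))\<^sup>2 = \<theta>"
    unfolding \<theta>_def g_def
    by (rule ind_dMV_nonneg_scalar[OF M meas[OF t] meas[OF s] unit[OF t] unit[OF s]])
  have g_meas [measurable]: "g \<in> borel_measurable (M \<Otimes>\<^sub>M M)"
    unfolding g_def by measurable
  have sq: "0 \<le> (a - b)\<^sup>2 \<and> (a - b)\<^sup>2 \<le> 1" if "0 \<le> a \<and> a \<le> 1" "0 \<le> b \<and> b \<le> 1" for a b :: real
    using that by (auto simp: abs_square_le_1)
  have g_pair: "AE v in M \<Otimes>\<^sub>M M. 0 \<le> g v \<and> g v \<le> 1"
    using AE_pair_fst_snd[OF M M unit[OF t] unit[OF s]]
    by eventually_elim (unfold g_def, rule sq, auto)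
  have g_diag: "AE w in M. 0 \<le> g (w, w) \<and> g (w, w) \<le> 1"
    using unit[OF t] unit[OF s] by eventually_elim (unfold g_def fst_conv snd_conv, rule sq, auto)
  have XX_entry: "XX r z $ j $ 1 = X r (\<omega> j z)" for r z j
    by (simp add: XX_def latent_matrix_def scalar_rv_def)
  have nonneg: "AE z in N. \<forall>j. 0 \<le> X t (\<omega> j z) \<and> 0 \<le> X s (\<omega> j z)"
  proof -
    have "AE z in N. 0 \<le> X r (\<omega> j z)" if r: "r \<in> {1..m}" for r j
    proof -
      have "AE w in distr N M (\<omega> j). 0 \<le> X r w"
        unfolding iid_law using unit[OF r] by eventually_elim simp
      from AE_distrD[OF om this] show ?thesis .
    qed
    then show ?thesis using t s by (simp add: AE_conj_iff AE_all_countable)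
  qed
  \<comment> \<open>The statistic as a function of the family of latent matrices: the independence hypothesis
      concerns this family, not the sample points themselves.\<close>
  define F where "F = (\<lambda>p (h :: nat \<Rightarrow> real^1^'n). dMV_hat_sq (h t) (perm_matrix p ** h s))"
  define bad where "bad = (\<lambda>p. {z \<in> space N. \<bar>F p (\<lambda>r\<in>{1..m}. XX r z) - \<theta>\<bar> \<ge> \<epsilon>})"
  let ?P = "\<Pi>\<^sub>M r\<in>{1..m}. (borel :: (real^1^'n) measure)"
  have F_meas: "F p \<in> borel_measurable ?P" for p
  proof -
    have [measurable]: "(\<lambda>h. h r $ j $ 1) \<in> borel_measurable ?P" if "r \<in> {1..m}" for r j
    proof -
      have "(\<lambda>v :: real^1^'n. v $ j $ 1) \<in> borel_measurable borel"
        by (intro borel_measurable_continuous_onI continuous_intros)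
      from measurable_compose[OF measurable_component_singleton[OF that] this] show ?thesis .
    qed
    note [measurable] = this[OF t] this[OF s]
    show ?thesis
      unfolding F_def dMV_hat_sq_scalar perm_matrix_row by measurable
  qed
  have XX_meas [measurable]: "(\<lambda>z. \<lambda>r\<in>{1..m}. XX r z) \<in> measurable N ?P"
    and \<sigma>_meas [measurable]: "\<sigma> \<in> measurable N (count_space S)"
    using sigma_indep by (auto simp: indep_rv_def)
  have bad_sets [measurable]: "bad p \<in> sets N" for p
    using measurable_compose[OF XX_meas F_meas] unfolding bad_def by measurable
  have S_fin: "finite S" unfolding S_def by (rule finite_permutations) simp
  have S_card: "card S = fact CARD('n)" unfolding S_def by (rule card_permutations) simp_all
  have \<sigma>_S: "\<sigma> z \<in> S" if "z \<in> space N" for z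
    using measurable_space[OF \<sigma>_meas that] by simp
  have \<sigma>_sets: "\<sigma> -` {p} \<inter> space N \<in> sets N" if "p \<in> S" for p
    using that by (intro measurable_sets[OF \<sigma>_meas]) auto
  have \<sigma>_prob: "measure N (\<sigma> -` {p} \<inter> space N) = 1 / fact CARD('n)" if "p \<in> S" for p
  proof -
    have "measure N (\<sigma> -` {p} \<inter> space N) = measure (uniform_count_measure S) {p}"
      using that by (simp add: sigma_law[symmetric] measure_distr)
    then show ?thesis using that S_fin S_card by (simp add: measure_uniform_count_measure)
  qed
  have split: "measure N (bad p \<inter> (\<sigma> -` {p} \<inter> space N))
      = measure N (bad p) * measure N (\<sigma> -` {p} \<inter> space N)" if "p \<in> S" for p
  proof (rule N.indep_setD)
    show "N.indep_set
       (sigma_sets (space N) {(\<lambda>z. \<lambda>r\<in>{1..m}. XX r z) -` a \<inter> space N | a. a \<in> sets ?P})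
       (sigma_sets (space N) {\<sigma> -` b \<inter> space N | b. b \<in> sets (count_space S)})"
      using sigma_indep by (simp add: indep_rv_def)
    have "{h \<in> space ?P. \<bar>F p h - \<theta>\<bar> \<ge> \<epsilon>} \<in> sets ?P"
      using F_meas[of p] by measurable
    moreover have "bad p = (\<lambda>z. \<lambda>r\<in>{1..m}. XX r z) -` {h \<in> space ?P. \<bar>F p h - \<theta>\<bar> \<ge> \<epsilon>} \<inter> space N"
      using measurable_space[OF XX_meas] by (auto simp: bad_def)
    ultimately show "bad p \<in> sigma_sets (space N)
        {(\<lambda>z. \<lambda>r\<in>{1..m}. XX r z) -` a \<inter> space N | a. a \<in> sets ?P}"
      by (intro sigma_sets.Basic) blast
    show "\<sigma> -` {p} \<inter> space N \<in> sigma_sets (space N) {\<sigma> -` b \<inter> space N | b. b \<in> sets (count_space S)}"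
      using that by (intro sigma_sets.Basic) auto
  qed
  have bad_prob: "measure N (bad p) \<le> (3 + real (card {j. p j = j})) / (n * \<epsilon>\<^sup>2)" if "p \<in> S" for p
  proof -
    define D where "D z = (\<Sum>j\<in>UNIV. g (\<omega> j z, \<omega> (p j) z)) / n - \<theta>" for z
    have D_meas [measurable]: "D \<in> borel_measurable N" unfolding D_def by measurable
    have p: "p permutes UNIV" using that by (simp add: S_def)
    note moment = permuted_kernel_second_moment[OF N iid_indep iid_law g_meas g_pair g_diag p,
        folded \<theta>_def n_def, folded D_def]
    have "AE z in N. z \<in> bad p \<longrightarrow> z \<in> {z \<in> space N. (D z)\<^sup>2 \<ge> \<epsilon>\<^sup>2}"
      using nonneg
    proof eventually_elim
      case (elim z)
      have "F p (\<lambda>r\<in>{1..m}. XX r z) - \<theta> = D z"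
        using elim t s
        by (simp add: F_def D_def dMV_hat_sq_nonneg_scalar perm_matrix_row XX_entry g_def n_def)
      then show ?case
        using eps by (auto simp: bad_def abs_le_square_iff[symmetric])
    qed
    then have "measure N (bad p) \<le> measure N {z \<in> space N. (D z)\<^sup>2 \<ge> \<epsilon>\<^sup>2}"
      by (rule N.finite_measure_mono_AE) measurable
    also have "\<dots> \<le> (LINT z|N. (D z)\<^sup>2) / \<epsilon>\<^sup>2"
      using eps by (intro integral_Markov_inequality_measure[where A = "{}"] moment(1)) auto
    also have "\<dots> \<le> (3 + real (card {j. p j = j})) / n / \<epsilon>\<^sup>2"
      by (intro divide_right_mono moment(2)) simp
    finally show ?thesis by simp
  qed
  have fixed: "(\<Sum>p\<in>S. real (card {j. p j = j})) = fact CARD('n)"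
  proof -
    have "(\<Sum>p\<in>S. real (card {j. p j = j})) = real (\<Sum>p\<in>S. card {j. p j = j})" by simp
    then show ?thesis unfolding S_def sum_card_fixed_points by simp
  qed
  have "{z \<in> space N. \<bar>dMV_hat_sq (XX t z) (perm_matrix (\<sigma> z) ** XX s z)
      - (ind_dMV M (scalar_rv (X t)) (scalar_rv (X s)))\<^sup>2\<bar> \<ge> \<epsilon>}
    = (\<Union>p\<in>S. bad p \<inter> (\<sigma> -` {p} \<inter> space N))"
    using \<sigma>_S t s by (auto simp: bad_def F_def \<theta>)
  also have "measure N \<dots> \<le> (\<Sum>p\<in>S. measure N (bad p \<inter> (\<sigma> -` {p} \<inter> space N)))"
    using S_fin \<sigma>_sets by (intro N.finite_measure_subadditive_finite) auto
  also have "\<dots> \<le> (\<Sum>p\<in>S. (3 + real (card {j. p j = j})) / (n * \<epsilon>\<^sup>2) * (1 / fact CARD('n)))"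
    by (intro sum_mono) (simp only: split \<sigma>_prob bad_prob mult_right_mono zero_le_divide_1_iff fact_ge_zero)
  also have "\<dots> = (\<Sum>p\<in>S. 3 + real (card {j. p j = j})) / (n * \<epsilon>\<^sup>2) / fact CARD('n)"
    by (simp add: sum_divide_distrib)
  also have "\<dots> = 4 / (n * \<epsilon>\<^sup>2)"
    by (simp add: sum.distrib fixed S_card)
  also have "\<dots> \<le> 12 / (n * \<epsilon>\<^sup>2) + 4 / (n * \<epsilon>)"
  proof -
    have "4 / (n * \<epsilon>\<^sup>2) \<le> 12 / (n * \<epsilon>\<^sup>2)"
      using eps by (intro divide_right_mono) (auto simp: n_def)
    moreover have "0 \<le> 4 / (n * \<epsilon>)"
      using eps by (simp add: n_def)
    ultimately show ?thesis by linarith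
  qed
  finally show ?thesis .
qed

end
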